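(* Let $n\ge 2$, let $\Omega\subset\mathbb{R}^n$ be a bounded convex domain, and let $u$ be the strictly convex solution (smooth in $\Omega$ and of class $C^2$ on $\overline{\Omega}$) of the Dirichlet problem $$\det D^2u=1\ \text{ in }\Omega,\qquad u=0\ \text{ on }\partial\Omega .$$ Then the function $$\varphi=\sum_{k,l=1}^n\frac{\partial\sigma_n(D^2u)}{\partial u_{kl}}\,u_ku_l-2u$$ attains its maximum (over $\overline{\Omega}$) on the boundary $\partial\Omega$.
   Context: Subscripts denote partial derivatives: $u_k=\partial u/\partial x_k$, $u_{kl}=\partial^2u/\partial x_k\partial x_l$, and $D^2u=(u_{kl})$ is the Hessian matrix. For a symmetric $n\times n$ matrix $W$ with eigenvalues $\lambda_1,\dots,\lambda_n$, $\sigma_k(W)=\sum_{1\le i_1<\cdots<i_k\le n}\lambda_{i_1}\cdots\lambda_{i_k}$; in particular $\sigma_n(W)=\det W$. The derivative $\partial\sigma_n(D^2u)/\partial u_{kl}$ is taken treating the $n^2$ matrix entries as independent variables, so it is the $(k,l)$ cofactor of $D^2u$; since $\det D^2u=1$ it equals the $(k,l)$ entry $u^{kl}$ of $(D^2u)^{-1}$. "Strictly convex" means that the Hessian $D^2u$ is positive definite. *)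

theory Defs
  imports "HOL-Analysis.Analysis" "HOL-Computational_Algebra.Fundamental_Theorem_Algebra"
begin

definition partial :: "'n::finite \<Rightarrow> (real^'n \<Rightarrow> real) \<Rightarrow> real^'n \<Rightarrow> real" where
  "partial k f x = deriv (\<lambda>t. f (x + t *\<^sub>R axis k 1)) 0"

text \<open>The head of the list is the last derivative taken.\<close>

definition partials :: "'n::finite list \<Rightarrow> (real^'n \<Rightarrow> real) \<Rightarrow> real^'n \<Rightarrow> real" where
  "partials ks f = foldr partial ks f"

text \<open>Since \<^const>\<open>deriv\<close> is total, the existence of the derivatives has to be demanded
  explicitly. The following definitions are meant for open \<open>S\<close>.\<close>

definition C_on :: "nat \<Rightarrow> (real^'n::finite) set \<Rightarrow> (real^'n \<Rightarrow> real) \<Rightarrow> bool" where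
  "C_on m S f \<longleftrightarrow>
     (\<forall>ks k. length ks < m \<longrightarrow>
        (\<forall>x\<in>S. (\<lambda>t. partials ks f (x + t *\<^sub>R axis k 1)) field_differentiable (at 0))) \<and>
     (\<forall>ks. length ks \<le> m \<longrightarrow> continuous_on S (partials ks f))"

definition smooth_on :: "(real^'n::finite) set \<Rightarrow> (real^'n \<Rightarrow> real) \<Rightarrow> bool" where
  "smooth_on S f \<longleftrightarrow> (\<forall>m. C_on m S f)"

text \<open>The class of functions that are \<open>C\<^sup>m\<close> on the closure of \<open>S\<close>: all derivatives of order at
  most \<open>m\<close> extend continuously from \<open>S\<close> to the closure, the function itself being its own
  extension.\<close>

definition C_closure :: "nat \<Rightarrow> (real^'n::finite) set \<Rightarrow> (real^'n \<Rightarrow> real) \<Rightarrow> bool" where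
  "C_closure m S f \<longleftrightarrow>
     C_on m S f \<and> continuous_on (closure S) f \<and>
     (\<forall>ks. length ks \<le> m \<longrightarrow>
        (\<exists>g. continuous_on (closure S) g \<and> (\<forall>x\<in>S. g x = partials ks f x)))"

text \<open>The boundary values of a function on \<open>S\<close> are the limits from inside \<open>S\<close>. This is how the
  derivatives of a function in \<^const>\<open>C_closure\<close> are understood on the boundary.\<close>

definition closure_ext :: "(real^'n::finite) set \<Rightarrow> (real^'n \<Rightarrow> real) \<Rightarrow> real^'n \<Rightarrow> real" where
  "closure_ext S f x = (if x \<in> S then f x else Lim (at x within S) f)"

definition hessian :: "(real^'n::finite) set \<Rightarrow> (real^'n \<Rightarrow> real) \<Rightarrow> real^'n \<Rightarrow> real^'n^'n" where
  "hessian S f x = (\<chi> k l. closure_ext S (partials [k, l] f) x)"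

definition pos_def :: "real^'n::finite^'n \<Rightarrow> bool" where
  "pos_def W \<longleftrightarrow> transpose W = W \<and> (\<forall>v. v \<noteq> 0 \<longrightarrow> v \<bullet> (W *v v) > 0)"

definition charpoly :: "real^'n::finite^'n \<Rightarrow> complex poly" where
  "charpoly W = det (\<chi> i j. (if i = j then [:0, 1:] else 0) - [:complex_of_real (W $ i $ j):])"

text \<open>The eigenvalues with multiplicity, in an arbitrary order on which \<open>sigma\<close> does not depend.\<close>

definition eigenvalues :: "real^'n::finite^'n \<Rightarrow> complex list" where
  "eigenvalues W = (SOME xs. mset xs = proots (charpoly W))"

text \<open>Differentiating with respect to single matrix entries leaves the symmetric matrices, so
  \<open>sigma\<close> is defined for every real matrix; its eigenvalues may be complex, but their elementary
  symmetric functions are real, because they are up to sign the coefficients of the characteristic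
  polynomial.\<close>

definition sigma :: "nat \<Rightarrow> real^'n::finite^'n \<Rightarrow> real" where
  "sigma k W = Re (\<Sum>I | I \<subseteq> {..<length (eigenvalues W)} \<and> card I = k. \<Prod>i\<in>I. eigenvalues W ! i)"

text \<open>The derivative with respect to the entry \<open>(k, l)\<close>, all entries being independent variables.\<close>

definition entry_deriv ::
    "(real^'n::finite^'n \<Rightarrow> real) \<Rightarrow> 'n \<Rightarrow> 'n \<Rightarrow> real^'n^'n \<Rightarrow> real" where
  "entry_deriv F k l W =
     deriv (\<lambda>t. F (\<chi> i j. if i = k \<and> j = l then t else W $ i $ j)) (W $ k $ l)"

definition phi :: "(real^'n::finite) set \<Rightarrow> (real^'n \<Rightarrow> real) \<Rightarrow> real^'n \<Rightarrow> real" where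
  "phi S u x =
     (\<Sum>k\<in>UNIV. \<Sum>l\<in>UNIV. entry_deriv (sigma CARD('n)) k l (hessian S u x) *
        closure_ext S (partial k u) x * closure_ext S (partial l u) x) - 2 * u x"

lemma prod_linear_coeff:
  fixes f :: "'b \<Rightarrow> 'a::comm_ring_1 poly"
  assumes "finite S" "\<And>i. i \<in> S \<Longrightarrow> degree (f i) \<le> 1"
  shows "degree (prod f S) \<le> card S \<and> coeff (prod f S) (card S) = (\<Prod>i\<in>S. coeff (f i) 1)"
  using assms
proof (induction S rule: finite_induct)
  case (insert x S)
  have IH: "degree (prod f S) \<le> card S" "coeff (prod f S) (card S) = (\<Prod>i\<in>S. coeff (f i) 1)"
    using insert by auto
  have "degree (f x) \<le> 1" using insert by auto
  then obtain a b where ab: "f x = [:a, b:]"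
    by (metis degree1_coeffs degree_0_id le_neq_implies_less less_one pCons_0_0 degree_eq_zeroE)
  have "degree (f x * prod f S) \<le> 1 + card S"
    using degree_mult_le[of "f x" "prod f S"] IH(1) \<open>degree (f x) \<le> 1\<close> by linarith
  moreover have "coeff (prod f S) (Suc (card S)) = 0"
    using IH(1) by (intro coeff_eq_0) auto
  ultimately show ?case
    using insert IH by (simp add: ab)
qed simp

lemma charpoly_monic:
  fixes W :: "real^'n::finite^'n"
  shows "degree (charpoly W) = CARD('n)" "lead_coeff (charpoly W) = 1"
proof -
  define M :: "complex poly^'n^'n" where
    "M = (\<chi> i j. (if i = j then [:0, 1:] else 0) - [:complex_of_real (W $ i $ j):])"
  have deg1: "degree (M $ i $ j) \<le> 1" and c1: "coeff (M $ i $ j) 1 = (mat 1 :: complex^'n^'n) $ i $ j"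
    for i j by (auto simp: M_def mat_def)
  have P: "degree (\<Prod>i\<in>UNIV. M $ i $ p i) \<le> CARD('n)"
    "coeff (\<Prod>i\<in>UNIV. M $ i $ p i) CARD('n) = (\<Prod>i\<in>UNIV. (mat 1 :: complex^'n^'n) $ i $ p i)" for p
    using prod_linear_coeff[of UNIV "\<lambda>i. M $ i $ p i"] deg1 c1 by auto
  have sg: "of_int (sign p) * q = smult (of_int (sign p)) q" for p :: "'n \<Rightarrow> 'n" and q :: "complex poly"
    by (simp add: of_int_poly)
  have cd: "charpoly W = (\<Sum>p | p permutes (UNIV :: 'n set).
      smult (of_int (sign p)) (\<Prod>i\<in>UNIV. M $ i $ p i))"
    unfolding charpoly_def M_def[symmetric] det_def sg ..
  have "coeff (charpoly W) CARD('n) = det (mat 1 :: complex^'n^'n)"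
    by (simp add: cd coeff_sum P(2) det_def)
  hence c: "coeff (charpoly W) CARD('n) = 1" by simp
  have "degree (charpoly W) \<le> CARD('n)"
    unfolding cd by (intro degree_sum_le) (auto intro: order.trans[OF degree_smult_le] P(1))
  thus "degree (charpoly W) = CARD('n)"
    using c by (metis le_degree le_antisym zero_neq_one)
  thus "lead_coeff (charpoly W) = 1" using c by simp
qed

lemma poly_charpoly_0: "poly (charpoly W) 0 = (- 1) ^ CARD('n) * complex_of_real (det W)"
  for W :: "real^'n::finite^'n"
  by (simp add: charpoly_def det_def poly_sum poly_prod prod_uminus sum_distrib_left
      of_int_poly ac_simps if_distrib[of "\<lambda>p. poly p 0"] cong: if_cong)

lemma mset_eigenvalues: "mset (eigenvalues W) = proots (charpoly W)"
  unfolding eigenvalues_def by (rule someI_ex) (rule ex_mset)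

lemma length_eigenvalues: "length (eigenvalues W) = CARD('n)" for W :: "real^'n::finite^'n"
  by (metis mset_eigenvalues size_mset size_proots_complex charpoly_monic(1))

theorem sigma_top_eq_det: "sigma CARD('n) W = det W" for W :: "real^'n::finite^'n"
proof -
  let ?xs = "eigenvalues W"
  have "{I. I \<subseteq> {..<CARD('n)} \<and> card I = CARD('n)} = {{..<CARD('n)}}"
    by (auto dest: card_subset_eq[rotated])
  hence "sigma CARD('n) W = Re (prod_list ?xs)"
    by (simp add: sigma_def length_eigenvalues prod.list_conv_set_nth atLeast0LessThan)
  moreover have "charpoly W = (\<Prod>x\<leftarrow>?xs. [:- x, 1:])"
    using complex_poly_decompose_multiset[of "charpoly W"] charpoly_monic(2)[of W]
    by (simp flip: mset_eigenvalues prod_mset_prod_list mset_map)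
  moreover have "poly (\<Prod>x\<leftarrow>xs. [:- x, 1:]) 0 = (- 1) ^ length xs * prod_list xs" for xs :: "complex list"
    by (induction xs) auto
  ultimately have "complex_of_real (det W) = prod_list ?xs"
    using poly_charpoly_0[of W] by (simp add: length_eigenvalues)
  with \<open>sigma CARD('n) W = Re (prod_list ?xs)\<close> show ?thesis
    by (metis Re_complex_of_real)
qed

end

theory Submission
  imports Defs
begin

text \<open>
  Let \<open>v\<close> be the Legendre transform of \<open>u\<close>, a function of the gradient variable \<open>y = Du(x)\<close>:
  \<open>v(y) = x \<bullet> y - u(x)\<close>, \<open>Dv(y) = x\<close> and \<open>D\<^sup>2v(y) = (D\<^sup>2u(x))\<^sup>-\<^sup>1\<close>. Then \<open>det D\<^sup>2v = 1\<close>, and since the cofactors of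
  \<open>D\<^sup>2u\<close> are the entries of its inverse, \<open>\<phi>(x) = P(y)\<close> with \<open>P = 2 v - 2 y \<bullet> Dv + y \<bullet> (D\<^sup>2v y)\<close>. This is the
  second derivative at \<open>\<rho> = 1\<close> of the dilations \<open>\<rho>\<^sup>2 v(y / \<rho>)\<close>
  (\<open>dilation_parameter_derivative\<close>), which solve the same equation.

  The operator \<open>log det D\<^sup>2\<close> is concave, so the second derivative of a family of solutions is a
  subsolution of the linearized equation, whose operator is \<open>L f = tr((D\<^sup>2v)\<^sup>-\<^sup>1 D\<^sup>2f)\<close>. Thus \<open>L P \<ge> 0\<close>, and
  the maximum principle forbids \<open>P\<close> to exceed its boundary values.

  To stay with second derivatives of \<open>v\<close>, this is carried out for differences. For convex solutions \<open>w\<close> of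
  \<open>det D\<^sup>2w = 1\<close> the inequality of arithmetic and geometric means gives \<open>L w \<ge> n\<close>, with equality for
  \<open>w = v\<close> (\<open>trace_inverse_mult_ge_dimension\<close>). So the second difference in \<open>\<rho>\<close> of the dilations, plus a
  small positive multiple of \<open>v\<close>, satisfies \<open>L F > 0\<close> and has no interior maximum
  (\<open>dilation_second_difference_not_locally_maximal\<close>). The second difference quotients converge to \<open>P\<close>
  uniformly on compact sets (\<open>dilation_second_difference_uniform\<close>), which gives the maximum principle for
  \<open>P\<close> on compact sets (\<open>dilation_second_derivative_maximum_principle\<close>).

  If \<open>\<phi>\<close> exceeded its maximum over \<open>\<partial>\<Omega>\<close> somewhere, then a superlevel set of \<open>\<phi>\<close> would be a compact
  subset of \<open>\<Omega>\<close>, and its image under \<open>Du\<close> would violate that principle.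
\<close>

section \<open>Pairs of quadratic forms\<close>

lemma linear_coefficient_zero_of_nonneg_quadratic:
  fixes a b :: real
  assumes "\<And>t. 0 \<le> 2 * t * a + t\<^sup>2 * b"
  shows "a = 0"
proof (rule ccontr)
  assume "a \<noteq> 0"
  have "0 \<le> b" using assms[of 1] assms[of "-1"] by simp
  \<comment> \<open>For \<open>b > 0\<close> the minimum is at \<open>- a / b\<close>; the denominator \<open>b + 1\<close> also serves \<open>b = 0\<close>.\<close>
  define t where "t = - a / (b + 1)"
  have a: "a = - t * (b + 1)"
    using \<open>0 \<le> b\<close> by (simp add: t_def field_simps)
  have "0 \<le> 2 * t * a + t\<^sup>2 * b" by (rule assms)
  also have "\<dots> = - (t\<^sup>2 * (b + 2))"
    by (simp add: a power2_eq_square algebra_simps)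
  also have "\<dots> < 0"
    using \<open>0 \<le> b\<close> \<open>a \<noteq> 0\<close> a by (auto simp: zero_less_mult_iff)
  finally show False by simp
qed

lemma symmetric_form_commute:
  fixes A :: "real^'n::finite^'n"
  assumes "transpose A = A"
  shows "x \<bullet> (A *v y) = y \<bullet> (A *v x)"
  by (metis assms dot_lmul_matrix inner_commute vector_transpose_matrix)

text \<open>One step of the spectral theorem for the pencil of \<open>A\<close> and \<open>B\<close>: the Rayleigh quotient attains its
  maximum \<open>l\<close> on the unit vectors of the \<open>A\<close>-orthogonal complement \<open>W\<close> of the eigenvectors found so
  far. The form \<open>C\<close> of \<open>l A - B\<close> is nonnegative on \<open>W\<close> and vanishes at a maximizer \<open>q\<close>, so \<open>C w q = 0\<close>
  for all \<open>w\<close> in \<open>W\<close>. The same holds for the earlier eigenvectors \<open>w\<close>, which together with \<open>W\<close> span the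
  whole space.\<close>

lemma generalized_eigenvector_exists:
  fixes A B :: "real^'n::finite^'n" and p :: "'n \<Rightarrow> real^'n"
  assumes A: "pos_def A" and B: "transpose B = B"
    and I: "card I < CARD('n)"
    and eig: "\<And>j. j \<in> I \<Longrightarrow> B *v p j = c j *\<^sub>R (A *v p j)"
    and orth: "\<And>i j. i \<in> I \<Longrightarrow> j \<in> I \<Longrightarrow> p i \<bullet> (A *v p j) = (if i = j then 1 else 0)"
  obtains q l where "B *v q = l *\<^sub>R (A *v q)" "q \<bullet> (A *v q) = 1"
    "\<And>j. j \<in> I \<Longrightarrow> q \<bullet> (A *v p j) = 0"
proof -
  have symA: "transpose A = A" and posA: "\<And>v. v \<noteq> 0 \<Longrightarrow> 0 < v \<bullet> (A *v v)"
    using A by (auto simp: pos_def_def)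
  define W where "W = {x. \<forall>j\<in>I. x \<bullet> (A *v p j) = 0}"
  define S where "S = W \<inter> sphere 0 1"
  define R where "R x = (x \<bullet> (B *v x)) / (x \<bullet> (A *v x))" for x
  have "dim ((\<lambda>j. A *v p j) ` I) < DIM(real^'n)"
    using dim_le_card'[OF finite_imageI[OF finite[of I]], of "\<lambda>j. A *v p j"] card_image_le[OF finite[of I], of "\<lambda>j. A *v p j"] I 
    by simp
  then obtain x0 where x0: "x0 \<noteq> 0" "\<And>y. y \<in> span ((\<lambda>j. A *v p j) ` I) \<Longrightarrow> orthogonal x0 y"
    by (rule orthogonal_to_subspace_exists) blast
  have x0W: "x0 \<in> W"
    using x0(2)[OF span_base] by (auto simp: W_def orthogonal_def)
  have Wsub: "a *\<^sub>R x + b *\<^sub>R y \<in> W" if "x \<in> W" "y \<in> W" for x y a b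
    using that by (simp add: W_def inner_add_left)
  have "(1 / norm x0) *\<^sub>R x0 \<in> S"
    using Wsub[OF x0W x0W, of "1 / norm x0" 0] x0(1) by (simp add: S_def)
  hence "S \<noteq> {}" by auto
  moreover have "closed W"
    unfolding W_def Ball_def
    by (intro closed_Collect_all closed_Collect_imp open_Collect_const closed_Collect_eq continuous_intros)
  hence "compact S"
    unfolding S_def by (simp add: closed_Int_compact)
  moreover have "continuous_on S R"
    unfolding R_def
    by (intro continuous_intros matrix_vector_mult_linear_continuous_on)
       (metis IntD2 S_def mem_sphere_0 norm_zero order_less_irrefl posA zero_neq_one)
  ultimately obtain q where q: "q \<in> S" "\<And>x. x \<in> S \<Longrightarrow> R x \<le> R q"
    using continuous_attains_sup by metis
  have qW: "q \<in> W" and q0: "q \<noteq> 0" using q(1) by (auto simp: S_def)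
  define l where "l = R q"
  define C where "C x y = l * (x \<bullet> (A *v y)) - x \<bullet> (B *v y)" for x y
  have Cadd: "C (x + y) z = C x z + C y z" "C z (x + y) = C z x + C z y"
    "C (a *\<^sub>R x) z = a * C x z" "C z (a *\<^sub>R x) = a * C z x" for x y z a
    by (simp_all add: C_def inner_add_left inner_add_right matrix_vector_right_distrib
        matrix_vector_mult_scaleR algebra_simps)
  have Csym: "C x y = C y x" for x y
    using symmetric_form_commute[OF symA] symmetric_form_commute[OF B] by (metis C_def)
  have Cnn: "0 \<le> C w w" if "w \<in> W" for w
  proof (cases "w = 0")
    case False
    define w' where "w' = (1 / norm w) *\<^sub>R w"
    have "w' \<in> S" using Wsub[OF that that, of "1 / norm w" 0] False by (simp add: S_def w'_def)
    hence "R w' \<le> l" using q(2) by (simp add: l_def)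
    moreover have "R w' = R w" using False
      by (simp add: R_def w'_def matrix_vector_mult_scaleR)
    ultimately have "(w \<bullet> (B *v w)) / (w \<bullet> (A *v w)) \<le> l" by (simp add: R_def)
    thus ?thesis using posA[OF False] by (simp add: C_def pos_divide_le_eq)
  qed (simp add: C_def)
  have Cqq: "C q q = 0"
    using posA[OF q0] by (simp add: C_def l_def R_def)
  have CW: "C w q = 0" if "w \<in> W" for w
  proof (rule linear_coefficient_zero_of_nonneg_quadratic)
    fix t
    have "0 \<le> C (q + t *\<^sub>R w) (q + t *\<^sub>R w)"
      using Cnn[of "q + t *\<^sub>R w"] Wsub[OF qW that, of 1 t] by simp
    thus "0 \<le> 2 * t * C w q + t\<^sup>2 * C w w"
      by (simp add: Cadd Cqq Csym[of q w] power2_eq_square algebra_simps)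
  qed
  have Cp: "C q (p j) = 0" if "j \<in> I" for j
    using qW that by (simp add: C_def eig W_def)
  \<comment> \<open>Subtracting the \<open>A\<close>-orthogonal projection \<open>s\<close> onto the earlier eigenvectors moves \<open>z\<close> into \<open>W\<close>.\<close>
  have "C z q = 0" for z
  proof -
    define s where "s = (\<Sum>j\<in>I. (z \<bullet> (A *v p j)) *\<^sub>R p j)"
    have sI: "s \<bullet> (A *v p i) = z \<bullet> (A *v p i)" if "i \<in> I" for i
      using that  by (simp add: s_def inner_sum_left orth if_distrib cong: if_cong)
    hence "z - s \<in> W" by (simp add: W_def inner_diff_left)
    hence "C (z - s) q = 0" by (rule CW)
    moreover have "C s q = 0"
    proof -
      have "C s q = (\<Sum>j\<in>I. (z \<bullet> (A *v p j)) * C (p j) q)"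
        by (simp add: C_def s_def inner_sum_left sum_distrib_left sum_subtractf algebra_simps)
      thus ?thesis using Cp Csym by simp
    qed
    ultimately show ?thesis using Cadd(1)[of "z - s" s q] by simp
  qed
  hence "z \<bullet> (l *\<^sub>R (A *v q) - B *v q) = 0" for z
    by (simp add: C_def inner_diff_right)
  hence "l *\<^sub>R (A *v q) - B *v q = 0" using inner_eq_zero_iff by blast
  hence Bq: "B *v q = l *\<^sub>R (A *v q)" by simp
  define k where "k = 1 / sqrt (q \<bullet> (A *v q))"
  show thesis
  proof (rule that)
    show "B *v (k *\<^sub>R q) = l *\<^sub>R (A *v (k *\<^sub>R q))"
      by (simp add: matrix_vector_mult_scaleR Bq)
    have "0 < q \<bullet> (A *v q)" by (rule posA[OF q0])
    thus "(k *\<^sub>R q) \<bullet> (A *v (k *\<^sub>R q)) = 1"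
      by (simp add: matrix_vector_mult_scaleR k_def)
    show "(k *\<^sub>R q) \<bullet> (A *v p j) = 0" if "j \<in> I" for j
      using qW that by (simp add: W_def)
  qed
qed

lemma simultaneous_diagonalization:
  fixes A B :: "real^'n::finite^'n"
  assumes A: "pos_def A" and B: "transpose B = B"
  obtains p :: "'n \<Rightarrow> real^'n" and c :: "'n \<Rightarrow> real"
  where "\<And>j. B *v p j = c j *\<^sub>R (A *v p j)"
    and "\<And>i j. p i \<bullet> (A *v p j) = (if i = j then 1 else 0)"
proof -
  have symA: "transpose A = A"
    using A by (simp add: pos_def_def)
  have "\<exists>p c. (\<forall>j\<in>I. B *v p j = c j *\<^sub>R (A *v p j)) \<and>
      (\<forall>i\<in>I. \<forall>j\<in>I. p i \<bullet> (A *v p j) = (if i = j then 1 else 0))" for I :: "'n set"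
    using finite[of I]
  proof (induction I rule: finite_induct)
    case (insert k I)
    then obtain p :: "'n \<Rightarrow> real^'n" and c where
      p: "\<And>j. j \<in> I \<Longrightarrow> B *v p j = c j *\<^sub>R (A *v p j)"
      "\<And>i j. i \<in> I \<Longrightarrow> j \<in> I \<Longrightarrow> p i \<bullet> (A *v p j) = (if i = j then 1 else 0)"
      by blast
    have "card I < CARD('n)"
      using insert.hyps(2) by (intro psubset_card_mono) auto
    from generalized_eigenvector_exists[OF A B this p] obtain q l where
      q: "B *v q = l *\<^sub>R (A *v q)" "q \<bullet> (A *v q) = 1" "\<And>j. j \<in> I \<Longrightarrow> q \<bullet> (A *v p j) = 0"
      by metis
    have q': "p j \<bullet> (A *v q) = 0" if "j \<in> I" for j
      using q(3)[OF that] symmetric_form_commute[OF symA] by metis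
    show ?case
      using insert.hyps(2) p q q'
      by (intro exI[of _ "p(k := q)"] exI[of _ "c(k := l)"]) auto
  qed simp
  from this[of UNIV] show thesis using that by auto
qed

text \<open>The inequality of arithmetic and geometric means for numbers of product one, by \<open>ln c \<le> c - 1\<close>.\<close>

lemma sum_ge_card_of_prod_eq_1:
  fixes c :: "'a \<Rightarrow> real"
  assumes "finite I" "\<And>i. i \<in> I \<Longrightarrow> 0 < c i" "prod c I = 1"
  shows "real (card I) \<le> sum c I"
proof -
  have "0 = (\<Sum>i\<in>I. ln (c i))"
    using ln_prod[of I c] assms by fastforce
  also have "\<dots> \<le> (\<Sum>i\<in>I. c i - 1)"
    using assms by (intro sum_mono ln_le_minus_one) auto
  finally show ?thesis by (simp add: sum_subtractf)
qed

lemma gram_matrix_of_form: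
  fixes N :: "real^'n::finite^'n" and p :: "'n \<Rightarrow> real^'n"
  shows "transpose (\<chi> i j. p j $ i) ** (N ** (\<chi> i j. p j $ i)) = (\<chi> i j. p i \<bullet> (N *v p j))"
  by (simp add: vec_eq_iff matrix_matrix_mult_def transpose_def inner_vec_def matrix_vector_mult_def)

text \<open>The matrix \<open>P\<close> with columns \<open>p i\<close> satisfies \<open>P\<^sup>T A P = 1\<close>, hence \<open>P P\<^sup>T = A\<^sup>-\<^sup>1\<close>, and the trace is cyclic. The
  point is that the right-hand side does not depend on the choice of the \<open>A\<close>-orthonormal basis, so
  that the forms of different matrices \<open>M\<close> can be summed over one and the same basis.\<close>

lemma trace_eq_sum_over_orthonormal_basis:
  fixes A A' M :: "real^'n::finite^'n" and p :: "'n \<Rightarrow> real^'n"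
  assumes p: "\<And>i j. p i \<bullet> (A *v p j) = (if i = j then 1 else 0)"
    and A': "A ** A' = mat 1"
  shows "trace (A' ** M) = (\<Sum>i\<in>UNIV. p i \<bullet> (M *v p i))"
proof -
  define P :: "real^'n^'n" where "P = (\<chi> i j. p j $ i)"
  note conj = gram_matrix_of_form[of p, folded P_def]
  have "(transpose P ** A) ** P = mat 1"
    using conj[of A] p by (simp add: matrix_mul_assoc[symmetric] mat_def)
  hence "P ** (transpose P ** A) = mat 1"
    using matrix_left_right_inverse by blast
  hence "(P ** (transpose P ** A)) ** A' = A'" by simp
  hence "P ** transpose P = A'"
    by (simp add: matrix_mul_assoc[symmetric] A')
  hence "trace (A' ** M) = trace (P ** (transpose P ** M))"
    by (simp add: matrix_mul_assoc)
  also have "\<dots> = trace (transpose P ** (M ** P))"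
    by (metis trace_mul_sym matrix_mul_assoc)
  also have "\<dots> = (\<Sum>i\<in>UNIV. p i \<bullet> (M *v p i))"
    by (simp add: conj trace_def)
  finally show ?thesis .
qed

text \<open>The eigenvalues of \<open>B\<close> relative to \<open>A\<close> are positive with product \<open>det B / det A = 1\<close>, and their sum is
  the trace. This is the concavity of \<open>log det\<close> in the only form in which the equation is used.\<close>

lemma trace_inverse_mult_ge_dimension:
  fixes A A' B :: "real^'n::finite^'n"
  assumes A: "pos_def A" "det A = 1" and B: "pos_def B" "det B = 1"
    and A': "A ** A' = mat 1"
  shows "real CARD('n) \<le> trace (A' ** B)"
proof -
  have "transpose B = B"
    using B(1) by (simp add: pos_def_def)
  then obtain p :: "'n \<Rightarrow> real^'n" and c where
    eig: "\<And>j. B *v p j = c j *\<^sub>R (A *v p j)" and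
    orth: "\<And>i j. p i \<bullet> (A *v p j) = (if i = j then 1 else 0)"
    using simultaneous_diagonalization[OF A(1)] by blast
  define P :: "real^'n^'n" where "P = (\<chi> i j. p j $ i)"
  note conj = gram_matrix_of_form[of p, folded P_def]
  have "transpose P ** (A ** P) = mat 1"
    by (simp add: conj orth mat_def)
  hence "det (transpose P ** (A ** P)) = 1" by simp
  hence detP: "det P * det P = 1"
    by (simp add: det_mul det_transpose A(2))
  have "det (transpose P ** (B ** P)) = prod c UNIV"
    by (subst det_diagonal) (auto simp: conj eig orth)
  hence prodc: "prod c UNIV = 1"
    using detP by (simp add: det_mul det_transpose B(2))
  have c: "p i \<bullet> (B *v p i) = c i" for i
    by (simp add: eig orth)
  have "p i \<noteq> 0" for i
    using orth[of i i] by auto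
  hence "0 < c i" for i
    using B(1) c[of i] unfolding pos_def_def by metis
  hence "real CARD('n) \<le> sum c UNIV"
    by (intro sum_ge_card_of_prod_eq_1) (auto simp: prodc)
  thus ?thesis
    by (simp add: trace_eq_sum_over_orthonormal_basis[OF orth A'] c)
qed

text \<open>If the form were nonpositive everywhere, then its sum over an \<open>A\<close>-orthonormal basis would be so too.
  But the terms of \<open>B\<close> and \<open>C\<close> contribute at least the dimension \<open>n\<close> each and those of \<open>A\<close> exactly
  \<open>k n - 2 n\<close>, which is \<open>k n > 0\<close> in total.\<close>

lemma second_difference_form_pos_somewhere:
  fixes A B C :: "real^'n::finite^'n"
  assumes A: "pos_def A" "det A = 1" and B: "pos_def B" "det B = 1" and C: "pos_def C" "det C = 1"
    and k: "0 < k"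
  obtains w where "0 < w \<bullet> (B *v w) + w \<bullet> (C *v w) - 2 * (w \<bullet> (A *v w)) + k * (w \<bullet> (A *v w))"
proof -
  obtain p :: "'n \<Rightarrow> real^'n" where
    orth: "\<And>i j. p i \<bullet> (A *v p j) = (if i = j then 1 else 0)"
    using simultaneous_diagonalization[OF A(1), of A] A(1) unfolding pos_def_def by metis
  obtain A' where A': "A ** A' = mat 1"
    using A(2) invertible_det_nz[of A] unfolding invertible_def by auto
  note tr = trace_eq_sum_over_orthonormal_basis[OF orth A']
  have B': "real CARD('n) \<le> (\<Sum>i\<in>UNIV. p i \<bullet> (B *v p i))"
    using trace_inverse_mult_ge_dimension[OF A B A'] by (simp add: tr)
  have C': "real CARD('n) \<le> (\<Sum>i\<in>UNIV. p i \<bullet> (C *v p i))"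
    using trace_inverse_mult_ge_dimension[OF A C A'] by (simp add: tr)
  have "0 < (\<Sum>i\<in>UNIV. p i \<bullet> (B *v p i) + p i \<bullet> (C *v p i)
      - 2 * (p i \<bullet> (A *v p i)) + k * (p i \<bullet> (A *v p i)))"
    using B' C' mult_pos_pos[OF k, of "real CARD('n)"]
    by (simp add: sum.distrib sum_subtractf orth mult.commute)
  then obtain i where "\<not> p i \<bullet> (B *v p i) + p i \<bullet> (C *v p i)
      - 2 * (p i \<bullet> (A *v p i)) + k * (p i \<bullet> (A *v p i)) \<le> 0"
    by (metis (no_types, lifting) sum_nonpos not_less)
  thus thesis by (intro that[of "p i"]) simp
qed

section \<open>Second derivatives and second differences\<close>

lemma second_derivative_test:
  fixes F :: "real^'n::finite \<Rightarrow> real"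
  assumes S: "open S" "y \<in> S"
    and F: "\<And>z. z \<in> S \<Longrightarrow> (F has_derivative (\<lambda>w. DF z \<bullet> w)) (at z)"
    and DF: "(DF has_derivative D2) (at y)"
    and max: "\<And>z. z \<in> S \<Longrightarrow> F z \<le> F y"
  shows "w \<bullet> D2 w \<le> 0"
proof (rule ccontr)
  assume "\<not> w \<bullet> D2 w \<le> 0"
  hence pos: "0 < w \<bullet> D2 w" by simp
  define f where "f t = F (y + t *\<^sub>R w)" for t :: real
  define f' where "f' t = DF (y + t *\<^sub>R w) \<bullet> w" for t :: real
  have "open ((\<lambda>t::real. y + t *\<^sub>R w) -` S)"
    by (intro open_vimage S continuous_intros)
  moreover have "0 \<in> (\<lambda>t::real. y + t *\<^sub>R w) -` S" using S by simp
  ultimately obtain e where e0: "0 < e" "ball 0 e \<subseteq> (\<lambda>t::real. y + t *\<^sub>R w) -` S"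
    by (rule openE)
  have e: "0 < e" "\<And>t. \<bar>t\<bar> < e \<Longrightarrow> y + t *\<^sub>R w \<in> S"
    using e0 by (auto simp: subset_iff dist_real_def)
  have f: "(f has_real_derivative f' t) (at t)" if "\<bar>t\<bar> < e" for t
  proof -
    have "((\<lambda>t::real. y + t *\<^sub>R w) has_derivative (\<lambda>s. s *\<^sub>R w)) (at t)"
      by (auto intro!: derivative_eq_intros)
    from has_derivative_compose[OF this F[OF e(2)[OF that]]]
    have "(f has_derivative (\<lambda>s. DF (y + t *\<^sub>R w) \<bullet> (s *\<^sub>R w))) (at t)"
      unfolding f_def .
    thus ?thesis by (simp add: has_field_derivative_def f'_def mult_commute_abs)
  qed
  have f0: "f' 0 = 0"
    using f[of 0] e max by (intro DERIV_local_max[of f _ 0 e]) (auto simp: f_def)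
  have "linear D2" using DF by (rule has_derivative_linear)
  have "(f' has_derivative (\<lambda>s. D2 (s *\<^sub>R w) \<bullet> w)) (at 0)"
  proof -
    have "((\<lambda>t::real. y + t *\<^sub>R w) has_derivative (\<lambda>s. s *\<^sub>R w)) (at 0)"
      by (auto intro!: derivative_eq_intros)
    from has_derivative_compose[OF this, of DF D2] DF
    show ?thesis unfolding f'_def by (auto intro!: derivative_eq_intros)
  qed
  hence "(f' has_real_derivative (w \<bullet> D2 w)) (at 0)"
    by (simp add: has_field_derivative_def linear_scale[OF \<open>linear D2\<close>] inner_commute mult_commute_abs)
  from DERIV_pos_inc_right[OF this pos] obtain d where
    d: "0 < d" "\<And>h. 0 < h \<Longrightarrow> h < d \<Longrightarrow> 0 < f' h" using f0 by auto
  define b where "b = min d e / 2"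
  have b: "0 < b" "b < d" "b < e" using d e by (auto simp: b_def min_def)
  have "f 0 < f b"
  proof (rule DERIV_pos_imp_increasing_open[OF b(1)])
    fix x assume "0 < x" "x < b"
    thus "\<exists>y. (f has_real_derivative y) (at x) \<and> y > 0"
      using f[of x] d(2)[of x] b by auto
  next
    show "continuous_on {0..b} f"
      using b by (intro DERIV_atLeastAtMost_imp_continuous_on) (use f in force)
  qed
  moreover have "f b \<le> f 0" using max[OF e(2)[of b]] b by (simp add: f_def)
  ultimately show False by simp
qed

text \<open>Taylor's formula of order two at \<open>a\<close> in both directions; the linear terms cancel.\<close>

lemma second_difference_eq_second_derivative:
  fixes q :: "real \<Rightarrow> real"
  assumes h: "0 < h"
    and q: "\<And>t. \<bar>t - a\<bar> \<le> h \<Longrightarrow> (q has_real_derivative q' t) (at t)"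
    and q': "\<And>t. \<bar>t - a\<bar> \<le> h \<Longrightarrow> (q' has_real_derivative q'' t) (at t)"
  obtains s t where "\<bar>s - a\<bar> \<le> h" "\<bar>t - a\<bar> \<le> h"
    "q (a + h) + q (a - h) - 2 * q a = h\<^sup>2 * (q'' s + q'' t) / 2"
proof -
  define diff where "diff n = (if n = 0 then q else if n = 1 then q' else q'')" for n :: nat
  have D: "\<forall>m t. m < 2 \<and> a - h \<le> t \<and> t \<le> a + h \<longrightarrow> DERIV (diff m) t :> diff (Suc m) t"
    using q q' by (auto simp: diff_def less_2_cases_iff)
  have *: "\<exists>t. \<bar>t - a\<bar> \<le> h \<and> q x = q a + q' a * (x - a) + q'' t / 2 * (x - a)\<^sup>2"
    if x: "\<bar>x - a\<bar> = h" for x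
  proof -
    have "\<exists>t. (if x < a then x < t \<and> t < a else a < t \<and> t < x) \<and>
      q x = (\<Sum>m<2. (diff m a / fact m) * (x - a)^m) + (diff 2 t / fact 2) * (x - a)^2"
      using h x by (intro Taylor[OF _ _ D]) (auto simp: diff_def)
    then obtain t where t: "if x < a then x < t \<and> t < a else a < t \<and> t < x"
      "q x = (\<Sum>m<2. (diff m a / fact m) * (x - a)^m) + (diff 2 t / fact 2) * (x - a)^2"
      by blast
    have "\<bar>t - a\<bar> \<le> h" using t(1) x by (auto split: if_splits)
    moreover have "q x = q a + q' a * (x - a) + q'' t / 2 * (x - a)\<^sup>2"
      using t(2) by (simp add: diff_def numeral_2_eq_2)
    ultimately show ?thesis by blast
  qed
  obtain s where s: "\<bar>s - a\<bar> \<le> h" "q (a + h) = q a + q' a * h + q'' s / 2 * h\<^sup>2"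
    using *[of "a + h"] h by auto
  obtain t where t: "\<bar>t - a\<bar> \<le> h" "q (a - h) = q a + q' a * (- h) + q'' t / 2 * h\<^sup>2"
    using *[of "a - h"] h by auto
  show thesis
    by (rule that[OF s(1) t(1)]) (use s t in \<open>simp add: field_simps\<close>)
qed

text \<open>The dilation \<open>y \<mapsto> \<rho>\<^sup>2 v (y / \<rho>)\<close> is normalized such that it leaves the values of the Hessian unchanged,
  as this lemma and the next one show; so it maps solutions of \<open>det D\<^sup>2v = 1\<close> to solutions.\<close>

lemma dilation_derivative:
  fixes v :: "real^'n::finite \<Rightarrow> real"
  assumes v: "(v has_derivative (\<lambda>w. g \<bullet> w)) (at (y /\<^sub>R \<rho>))" and "\<rho> \<noteq> 0"
  shows "((\<lambda>y. \<rho>\<^sup>2 * v (y /\<^sub>R \<rho>)) has_derivative (\<lambda>w. (\<rho> *\<^sub>R g) \<bullet> w)) (at y)"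
proof -
  have "((\<lambda>y. y /\<^sub>R \<rho>) has_derivative (\<lambda>w. w /\<^sub>R \<rho>)) (at y)"
    by (auto intro!: derivative_eq_intros)
  from has_derivative_compose[OF this v]
  have "((\<lambda>y. v (y /\<^sub>R \<rho>)) has_derivative (\<lambda>w. g \<bullet> (w /\<^sub>R \<rho>))) (at y)" .
  thus ?thesis using assms(2)
    by (auto intro!: derivative_eq_intros simp: power2_eq_square)
qed

lemma dilation_gradient_derivative:
  fixes G :: "real^'n::finite \<Rightarrow> real^'n"
  assumes G: "(G has_derivative (\<lambda>w. H *v w)) (at (y /\<^sub>R \<rho>))" and "\<rho> \<noteq> 0"
  shows "((\<lambda>y. \<rho> *\<^sub>R G (y /\<^sub>R \<rho>)) has_derivative (\<lambda>w. H *v w)) (at y)"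
proof -
  have "((\<lambda>y. y /\<^sub>R \<rho>) has_derivative (\<lambda>w. w /\<^sub>R \<rho>)) (at y)"
    by (auto intro!: derivative_eq_intros)
  from has_derivative_compose[OF this G]
  have "((\<lambda>y. G (y /\<^sub>R \<rho>)) has_derivative (\<lambda>w. H *v (w /\<^sub>R \<rho>))) (at y)" .
  from has_derivative_scaleR_right[OF this, of \<rho>] show ?thesis using assms(2)
    by (simp add: matrix_vector_mult_scaleR)
qed

text \<open>The second derivative in \<open>\<rho>\<close> is a function of the point \<open>z = y / \<rho>\<close> alone, namely
  \<open>2 v - 2 z \<bullet> Dv + z \<bullet> (D\<^sup>2v z)\<close> at \<open>z\<close>. When \<open>v\<close> is the Legendre transform of \<open>u\<close>, this is the function
  \<open>\<phi>\<close> at the point whose gradient is \<open>z\<close>.\<close>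

lemma dilation_parameter_derivative:
  fixes v :: "real^'n::finite \<Rightarrow> real"
  assumes v: "(v has_derivative (\<lambda>w. G (y /\<^sub>R \<rho>) \<bullet> w)) (at (y /\<^sub>R \<rho>))"
    and G: "(G has_derivative (\<lambda>w. H *v w)) (at (y /\<^sub>R \<rho>))" and "\<rho> \<noteq> 0"
  shows "((\<lambda>\<rho>. \<rho>\<^sup>2 * v (y /\<^sub>R \<rho>)) has_real_derivative
      2 * \<rho> * v (y /\<^sub>R \<rho>) - y \<bullet> G (y /\<^sub>R \<rho>)) (at \<rho>)"
    and "((\<lambda>\<rho>. 2 * \<rho> * v (y /\<^sub>R \<rho>) - y \<bullet> G (y /\<^sub>R \<rho>)) has_real_derivative
      2 * v (y /\<^sub>R \<rho>) - 2 * ((y /\<^sub>R \<rho>) \<bullet> G (y /\<^sub>R \<rho>)) + (y /\<^sub>R \<rho>) \<bullet> (H *v (y /\<^sub>R \<rho>))) (at \<rho>)"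
proof -
  have inv: "((\<lambda>\<rho>. y /\<^sub>R \<rho>) has_derivative (\<lambda>t. (- t / \<rho>\<^sup>2) *\<^sub>R y)) (at \<rho>)"
    using assms(3) by (auto intro!: derivative_eq_intros simp: power2_eq_square field_simps)
  have dv: "((\<lambda>\<rho>. v (y /\<^sub>R \<rho>)) has_real_derivative - (y \<bullet> G (y /\<^sub>R \<rho>)) / \<rho>\<^sup>2) (at \<rho>)"
    unfolding has_field_derivative_def
    by (rule has_derivative_eq_rhs[OF has_derivative_compose[OF inv v]])
       (auto simp: fun_eq_iff inner_commute)
  have "((\<lambda>\<rho>. y \<bullet> G (y /\<^sub>R \<rho>)) has_derivative (\<lambda>t. y \<bullet> (H *v ((- t / \<rho>\<^sup>2) *\<^sub>R y)))) (at \<rho>)"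
    using has_derivative_compose[OF inv G] by (rule has_derivative_inner_right)
  hence dG: "((\<lambda>\<rho>. y \<bullet> G (y /\<^sub>R \<rho>)) has_real_derivative - (y \<bullet> (H *v y)) / \<rho>\<^sup>2) (at \<rho>)"
    unfolding has_field_derivative_def
    by (rule has_derivative_eq_rhs) (simp only: fun_eq_iff matrix_vector_mult_scaleR, simp)
  show "((\<lambda>\<rho>. \<rho>\<^sup>2 * v (y /\<^sub>R \<rho>)) has_real_derivative
      2 * \<rho> * v (y /\<^sub>R \<rho>) - y \<bullet> G (y /\<^sub>R \<rho>)) (at \<rho>)"
    by (rule DERIV_cong[OF DERIV_mult[OF DERIV_power[OF DERIV_ident, of 2] dv]])
       (use assms(3) in simp)
  have "((\<lambda>\<rho>. 2 * \<rho> * v (y /\<^sub>R \<rho>) - y \<bullet> G (y /\<^sub>R \<rho>)) has_real_derivative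
      2 * v (y /\<^sub>R \<rho>) + 2 * \<rho> * (- (y \<bullet> G (y /\<^sub>R \<rho>)) / \<rho>\<^sup>2)
        - (- (y \<bullet> (H *v y)) / \<rho>\<^sup>2)) (at \<rho>)"
    by (rule DERIV_cong[OF DERIV_diff[OF DERIV_mult[OF DERIV_cmult[OF DERIV_ident, of 2] dv] dG]]) simp
  moreover have "2 * v (y /\<^sub>R \<rho>) + 2 * \<rho> * (- (y \<bullet> G (y /\<^sub>R \<rho>)) / \<rho>\<^sup>2)
        - (- (y \<bullet> (H *v y)) / \<rho>\<^sup>2)
      = 2 * v (y /\<^sub>R \<rho>) - 2 * ((y /\<^sub>R \<rho>) \<bullet> G (y /\<^sub>R \<rho>)) + (y /\<^sub>R \<rho>) \<bullet> (H *v (y /\<^sub>R \<rho>))"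
    using assms(3) by (simp add: matrix_vector_mult_scaleR power2_eq_square divide_inverse)
  ultimately show "((\<lambda>\<rho>. 2 * \<rho> * v (y /\<^sub>R \<rho>) - y \<bullet> G (y /\<^sub>R \<rho>)) has_real_derivative
      2 * v (y /\<^sub>R \<rho>) - 2 * ((y /\<^sub>R \<rho>) \<bullet> G (y /\<^sub>R \<rho>)) + (y /\<^sub>R \<rho>) \<bullet> (H *v (y /\<^sub>R \<rho>))) (at \<rho>)"
    by (simp only:)
qed

section \<open>The maximum principle for the second derivative of the dilations\<close>

text \<open>At a local maximum the Hessian of \<open>F\<close> would be nonpositive. It is the combination of the Hessians
  of \<open>v\<close> at the three points \<open>y / (1 + h)\<close>, \<open>y / (1 - h)\<close> and \<open>y\<close>, all of determinant one, which
  \<open>second_difference_form_pos_somewhere\<close> excludes. The term \<open>k v\<close> makes the inequality strict.\<close>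

lemma dilation_second_difference_not_locally_maximal:
  fixes v :: "real^'n::finite \<Rightarrow> real"
  assumes v: "\<And>y. y \<in> V \<Longrightarrow> (v has_derivative (\<lambda>w. G y \<bullet> w)) (at y)"
    and G: "\<And>y. y \<in> V \<Longrightarrow> (G has_derivative (\<lambda>w. A y *v w)) (at y)"
    and A: "\<And>y. y \<in> V \<Longrightarrow> pos_def (A y)" "\<And>y. y \<in> V \<Longrightarrow> det (A y) = 1"
    and h: "0 < h" "h < 1" and k: "0 < k"
    and S: "open S" "y \<in> S"
    and SV: "\<And>z. z \<in> S \<Longrightarrow> z \<in> V" "\<And>z. z \<in> S \<Longrightarrow> z /\<^sub>R (1 + h) \<in> V" "\<And>z. z \<in> S \<Longrightarrow> z /\<^sub>R (1 - h) \<in> V"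
    and F: "\<And>z. F z = (1 + h)\<^sup>2 * v (z /\<^sub>R (1 + h)) + (1 - h)\<^sup>2 * v (z /\<^sub>R (1 - h)) - 2 * v z + k * v z"
  shows "\<exists>z\<in>S. F y < F z"
proof (rule ccontr)
  assume "\<not> (\<exists>z\<in>S. F y < F z)"
  hence max: "\<And>z. z \<in> S \<Longrightarrow> F z \<le> F y" by (auto simp: not_less)
  define DF where "DF z = (1 + h) *\<^sub>R G (z /\<^sub>R (1 + h)) + (1 - h) *\<^sub>R G (z /\<^sub>R (1 - h))
      - 2 *\<^sub>R G z + k *\<^sub>R G z" for z
  define D2 where "D2 w = A (y /\<^sub>R (1 + h)) *v w + A (y /\<^sub>R (1 - h)) *v w
      - 2 *\<^sub>R (A y *v w) + k *\<^sub>R (A y *v w)" for w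
  have h': "1 + h \<noteq> 0" "1 - h \<noteq> 0" using h by auto
  have dF: "(F has_derivative (\<lambda>w. DF z \<bullet> w)) (at z)" if "z \<in> S" for z
  proof -
    note d = dilation_derivative[OF v[OF SV(2)[OF that]] h'(1)]
      dilation_derivative[OF v[OF SV(3)[OF that]] h'(2)] v[OF SV(1)[OF that]]
    show ?thesis
      unfolding F[abs_def]
      by (rule has_derivative_eq_rhs[OF has_derivative_add[OF has_derivative_diff[OF
            has_derivative_add[OF d(1) d(2)] has_derivative_mult_right[OF d(3), of 2]]
            has_derivative_mult_right[OF d(3), of k]]])
         (simp add: DF_def fun_eq_iff inner_add_left inner_diff_left)
  qed
  note d = dilation_gradient_derivative[OF G[OF SV(2)[OF S(2)]] h'(1)]
      dilation_gradient_derivative[OF G[OF SV(3)[OF S(2)]] h'(2)] G[OF SV(1)[OF S(2)]]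
  have dDF: "(DF has_derivative D2) (at y)"
    unfolding DF_def[abs_def] D2_def[abs_def]
    by (intro has_derivative_add has_derivative_diff has_derivative_scaleR_right d)
  have "w \<bullet> D2 w \<le> 0" for w
    by (rule second_derivative_test[OF S dF dDF max])
  moreover obtain w where "0 < w \<bullet> (A (y /\<^sub>R (1 + h)) *v w) + w \<bullet> (A (y /\<^sub>R (1 - h)) *v w)
      - 2 * (w \<bullet> (A y *v w)) + k * (w \<bullet> (A y *v w))"
    using second_difference_form_pos_somewhere[of "A y" "A (y /\<^sub>R (1 + h))" "A (y /\<^sub>R (1 - h))" k] A SV S k
    by metis
  ultimately show False
    by (simp add: D2_def inner_add_right inner_diff_right not_less[symmetric])
qed

text \<open>The second difference quotient at \<open>y\<close> is a mean of two values of \<open>P\<close> at points \<open>y / \<rho>\<close> with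
  \<open>\<bar>\<rho> - 1\<bar> \<le> h\<close>. These are uniformly close to \<open>y\<close>, and \<open>P\<close> is uniformly continuous near \<open>Y\<close>.\<close>

lemma dilation_second_difference_uniform:
  fixes v :: "real^'n::finite \<Rightarrow> real"
  assumes V: "open V"
    and v: "\<And>y. y \<in> V \<Longrightarrow> (v has_derivative (\<lambda>w. G y \<bullet> w)) (at y)"
    and G: "\<And>y. y \<in> V \<Longrightarrow> (G has_derivative (\<lambda>w. A y *v w)) (at y)"
    and P: "\<And>y. P y = 2 * v y - 2 * (y \<bullet> G y) + y \<bullet> (A y *v y)" "continuous_on V P"
    and Y: "compact Y" "Y \<subseteq> V" and e: "0 < e"
  obtains h where "0 < h" "h < 1"
    "\<And>y. y \<in> Y \<Longrightarrow> y /\<^sub>R (1 + h) \<in> V" "\<And>y. y \<in> Y \<Longrightarrow> y /\<^sub>R (1 - h) \<in> V"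
    "\<And>y. y \<in> Y \<Longrightarrow>
      \<bar>(1 + h)\<^sup>2 * v (y /\<^sub>R (1 + h)) + (1 - h)\<^sup>2 * v (y /\<^sub>R (1 - h)) - 2 * v y - h\<^sup>2 * P y\<bar> \<le> h\<^sup>2 * e"
proof -
  obtain r where r: "0 < r" "(\<Union>y\<in>Y. cball y r) \<subseteq> V"
    using compact_subset_open_imp_cball_epsilon_subset[OF Y(1) V Y(2)] by blast
  define Z where "Z = (\<Union>y\<in>Y. cball y r)"
  have "compact Z"
    unfolding Z_def using Y(1) by (rule compact_minkowski_sum_cball)
  hence "uniformly_continuous_on Z P"
    using compact_uniformly_continuous continuous_on_subset[OF P(2)] r(2) unfolding Z_def by blast
  then obtain d where d: "0 < d"
    "\<And>y z. y \<in> Z \<Longrightarrow> z \<in> Z \<Longrightarrow> dist z y < d \<Longrightarrow> \<bar>P z - P y\<bar> < e"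
    using e unfolding uniformly_continuous_on_def dist_real_def by metis
  obtain B where B: "0 < B" "\<And>y. y \<in> Y \<Longrightarrow> norm y \<le> B"
    using compact_imp_bounded[OF Y(1)] unfolding bounded_pos by blast
  \<comment> \<open>For \<open>\<rho> \<ge> 1 / 2\<close> the point \<open>y / \<rho>\<close> has distance at most \<open>2 B h\<close> from \<open>y\<close>.\<close>
  define h where "h = min (1 / 2) (min (r / (2 * B)) (d / (4 * B)))"
  have h: "0 < h" "h \<le> 1 / 2" "2 * B * h \<le> r" "2 * B * h < d"
  proof -
    show "0 < h" "h \<le> 1 / 2" using r(1) d(1) B(1) by (auto simp: h_def)
    have "h \<le> r / (2 * B)" "h \<le> d / (4 * B)" by (auto simp: h_def)
    thus "2 * B * h \<le> r" "2 * B * h < d" using B(1) d(1) by (auto simp: field_simps)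
  qed
  have close: "dist (y /\<^sub>R \<rho>) y \<le> 2 * B * h" if "y \<in> Y" "\<bar>\<rho> - 1\<bar> \<le> h" for y \<rho>
  proof -
    have \<rho>: "1 / 2 \<le> \<rho>" using that(2) h(2) by linarith
    have "y /\<^sub>R \<rho> - y = (inverse \<rho> - 1) *\<^sub>R y"
      by (simp add: scaleR_diff_left)
    also have "inverse \<rho> - 1 = (1 - \<rho>) / \<rho>"
      using \<rho> by (simp add: field_simps)
    finally have "y /\<^sub>R \<rho> - y = ((1 - \<rho>) / \<rho>) *\<^sub>R y" .
    hence "dist (y /\<^sub>R \<rho>) y = \<bar>\<rho> - 1\<bar> / \<rho> * norm y"
      using \<rho> by (simp add: dist_norm abs_minus_commute)
    also have "\<dots> \<le> (h / (1 / 2)) * B"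
      using \<rho> that B(2)[OF that(1)] by (intro mult_mono frac_le) auto
    finally show ?thesis by (simp add: mult_ac)
  qed
  have inZ: "y /\<^sub>R \<rho> \<in> Z" if "y \<in> Y" "\<bar>\<rho> - 1\<bar> \<le> h" for y \<rho>
    using close[OF that] h(3) that(1) unfolding Z_def by (force simp: dist_commute)
  have inV: "y /\<^sub>R \<rho> \<in> V" if "y \<in> Y" "\<bar>\<rho> - 1\<bar> \<le> h" for y \<rho>
    using inZ[OF that] r(2) unfolding Z_def by blast
  have near: "\<bar>P (y /\<^sub>R \<rho>) - P y\<bar> < e" if "y \<in> Y" "\<bar>\<rho> - 1\<bar> \<le> h" for y \<rho>
    using d(2)[OF _ inZ[OF that], of y] inZ[OF that(1), of 1] close[OF that] h by simp
  show thesis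
  proof (rule that)
    show "0 < h" "h < 1" using h by auto
    show "y /\<^sub>R (1 + h) \<in> V" "y /\<^sub>R (1 - h) \<in> V" if "y \<in> Y" for y
      using inV[OF that] h(1) by auto
    show "\<bar>(1 + h)\<^sup>2 * v (y /\<^sub>R (1 + h)) + (1 - h)\<^sup>2 * v (y /\<^sub>R (1 - h)) - 2 * v y - h\<^sup>2 * P y\<bar> \<le> h\<^sup>2 * e"
      if y: "y \<in> Y" for y
    proof -
      have nz: "\<rho> \<noteq> 0" if "\<bar>\<rho> - 1\<bar> \<le> h" for \<rho> :: real
        using that h(2) by auto
      note d1 = dilation_parameter_derivative(1)[where G=G and y=y, OF v[OF inV[OF y]] G[OF inV[OF y]] nz]
      note d2 = dilation_parameter_derivative(2)[where G=G and y=y, OF v[OF inV[OF y]] G[OF inV[OF y]] nz, folded P(1)]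
      obtain s t where st: "\<bar>s - 1\<bar> \<le> h" "\<bar>t - 1\<bar> \<le> h"
        "(1 + h)\<^sup>2 * v (y /\<^sub>R (1 + h)) + (1 - h)\<^sup>2 * v (y /\<^sub>R (1 - h)) - 2 * (1\<^sup>2 * v (y /\<^sub>R 1))
          = h\<^sup>2 * (P (y /\<^sub>R s) + P (y /\<^sub>R t)) / 2"
        using second_difference_eq_second_derivative[OF h(1), of 1 "\<lambda>\<rho>. \<rho>\<^sup>2 * v (y /\<^sub>R \<rho>)"
          "\<lambda>\<rho>. 2 * \<rho> * v (y /\<^sub>R \<rho>) - y \<bullet> G (y /\<^sub>R \<rho>)" "\<lambda>\<rho>. P (y /\<^sub>R \<rho>)"] d1 d2 by blast
      define X where "X = (P (y /\<^sub>R s) + P (y /\<^sub>R t) - 2 * P y) / 2"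
      have "(1 + h)\<^sup>2 * v (y /\<^sub>R (1 + h)) + (1 - h)\<^sup>2 * v (y /\<^sub>R (1 - h)) - 2 * v y - h\<^sup>2 * P y
          = h\<^sup>2 * X"
        using st(3) by (simp add: X_def algebra_simps)
      moreover have "\<bar>P (y /\<^sub>R s) + P (y /\<^sub>R t) - 2 * P y\<bar> \<le> 2 * e"
        using near[OF y st(1)] near[OF y st(2)] by linarith
      hence "\<bar>X\<bar> \<le> e" by (simp add: X_def)
      hence "\<bar>h\<^sup>2 * X\<bar> \<le> h\<^sup>2 * e"
        by (simp only: abs_mult abs_power2 mult_left_mono zero_le_power2)
      ultimately show ?thesis by (simp only:)
    qed
  qed
qed

text \<open>If \<open>P y0\<close> exceeded the values of \<open>P\<close> on the frontier by \<open>\<delta>\<close>, the same would hold, with a smaller gap, for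
  the second difference in \<open>\<rho>\<close> divided by \<open>h\<^sup>2\<close> plus a small multiple of \<open>v\<close>. That function would then
  have an interior maximum. Passing to differences avoids the third and fourth derivatives of \<open>v\<close>
  that a differential inequality for \<open>P\<close> would involve.\<close>

lemma dilation_second_derivative_maximum_principle:
  fixes v :: "real^'n::finite \<Rightarrow> real"
  assumes V: "open V"
    and v: "\<And>y. y \<in> V \<Longrightarrow> (v has_derivative (\<lambda>w. G y \<bullet> w)) (at y)"
    and G: "\<And>y. y \<in> V \<Longrightarrow> (G has_derivative (\<lambda>w. A y *v w)) (at y)"
    and A: "\<And>y. y \<in> V \<Longrightarrow> pos_def (A y)" "\<And>y. y \<in> V \<Longrightarrow> det (A y) = 1"
    and P: "\<And>y. P y = 2 * v y - 2 * (y \<bullet> G y) + y \<bullet> (A y *v y)" "continuous_on V P"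
    and Y: "compact Y" "Y \<subseteq> V" and y0: "y0 \<in> Y"
    and m: "\<And>y. y \<in> frontier Y \<Longrightarrow> P y \<le> m"
  shows "P y0 \<le> m"
proof (rule ccontr)
  assume "\<not> P y0 \<le> m"
  define \<delta> where "\<delta> = P y0 - m"
  have \<delta>: "0 < \<delta>" using \<open>\<not> P y0 \<le> m\<close> by (simp add: \<delta>_def)
  have contV: "continuous_on V v"
    using v by (intro continuous_at_imp_continuous_on) (blast intro: has_derivative_continuous)
  hence "compact (v ` Y)"
    using Y continuous_on_subset compact_continuous_image by blast
  then obtain B where B: "0 < B" "\<And>y. y \<in> Y \<Longrightarrow> \<bar>v y\<bar> \<le> B"
    using compact_imp_bounded[of "v ` Y"] unfolding bounded_pos by auto
  \<comment> \<open>The errors \<open>\<delta> / 8\<close> of the difference quotient and \<open>c B = \<delta> / 4\<close> of the term \<open>c v\<close>, each counted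
    at two points, add up to less than the gap \<open>\<delta>\<close>.\<close>
  define c where "c = \<delta> / (4 * B)"
  have c: "0 < c" "c * B = \<delta> / 4" using \<delta> B(1) by (auto simp: c_def)
  obtain h where h: "0 < h" "h < 1"
    and hV: "\<And>y. y \<in> Y \<Longrightarrow> y /\<^sub>R (1 + h) \<in> V" "\<And>y. y \<in> Y \<Longrightarrow> y /\<^sub>R (1 - h) \<in> V"
    and hP: "\<And>y. y \<in> Y \<Longrightarrow>
      \<bar>(1 + h)\<^sup>2 * v (y /\<^sub>R (1 + h)) + (1 - h)\<^sup>2 * v (y /\<^sub>R (1 - h)) - 2 * v y - h\<^sup>2 * P y\<bar> \<le> h\<^sup>2 * (\<delta> / 8)"
    using dilation_second_difference_uniform[OF V v G P Y, of "\<delta> / 8"] \<delta> by auto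
  define F where "F z = (1 + h)\<^sup>2 * v (z /\<^sub>R (1 + h)) + (1 - h)\<^sup>2 * v (z /\<^sub>R (1 - h)) - 2 * v z
      + (h\<^sup>2 * c) * v z" for z
  have FP: "\<bar>F y - h\<^sup>2 * P y\<bar> \<le> h\<^sup>2 * (\<delta> * 3 / 8)" if "y \<in> Y" for y
  proof -
    have "\<bar>(h\<^sup>2 * c) * v y\<bar> = h\<^sup>2 * (c * \<bar>v y\<bar>)" using c by (simp add: abs_mult)
    also have "\<dots> \<le> h\<^sup>2 * (\<delta> / 4)"
      using mult_left_mono[OF B(2)[OF that], of c] c by (intro mult_left_mono) auto
    finally show ?thesis using hP[OF that] unfolding F_def by linarith
  qed
  have "continuous_on Y (\<lambda>y. v (y /\<^sub>R \<rho>))" if "\<And>y. y \<in> Y \<Longrightarrow> y /\<^sub>R \<rho> \<in> V" for \<rho>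
    by (rule continuous_on_compose2[OF contV]) (use that in \<open>auto intro!: continuous_intros\<close>)
  from this[OF hV(1)] this[OF hV(2)] continuous_on_subset[OF contV Y(2)]
  have "continuous_on Y F"
    unfolding F_def by (intro continuous_on_add continuous_on_diff continuous_on_mult_left)
  then obtain y1 where y1: "y1 \<in> Y" "\<And>y. y \<in> Y \<Longrightarrow> F y \<le> F y1"
    using continuous_attains_sup[OF Y(1)] y0 by blast
  have "y1 \<notin> frontier Y"
  proof
    assume "y1 \<in> frontier Y"
    have "h\<^sup>2 * P y0 - h\<^sup>2 * (\<delta> * 3 / 8) \<le> h\<^sup>2 * P y1 + h\<^sup>2 * (\<delta> * 3 / 8)"
      using FP[OF y0] FP[OF y1(1)] y1(2)[OF y0] by linarith
    hence "h\<^sup>2 * (P y0 - \<delta> * 3 / 8) \<le> h\<^sup>2 * (P y1 + \<delta> * 3 / 8)" by (simp add: algebra_simps)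
    hence "P y0 - \<delta> * 3 / 8 \<le> P y1 + \<delta> * 3 / 8" using h(1) by simp
    moreover have "P y0 = m + \<delta>" by (simp add: \<delta>_def)
    ultimately show False using m[OF \<open>y1 \<in> frontier Y\<close>] \<delta> by linarith
  qed
  hence "y1 \<in> interior Y"
    using y1(1) by (simp add: frontier_def closure_closed compact_imp_closed Y(1))
  moreover have "0 < h\<^sup>2 * c" using h(1) c(1) by simp
  ultimately have "\<exists>z\<in>interior Y. F y1 < F z"
    by (intro dilation_second_difference_not_locally_maximal[of V v G A h "h\<^sup>2 * c"] v G A h)
       (use interior_subset[of Y] hV Y(2) in \<open>auto simp: F_def\<close>)
  thus False using y1(2) interior_subset by fastforce
qed

section \<open>Partial derivatives and the total derivative\<close>

text \<open>The increment \<open>w\<close> is built up one coordinate at a time. By the mean value theorem each coordinate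
  \<open>j\<close> contributes \<open>w $ j\<close> times a value of the \<open>j\<close>-th partial derivative at a point near \<open>x\<close>.\<close>

lemma has_derivative_of_continuous_partials:
  fixes f :: "real^'n::finite \<Rightarrow> real"
  assumes S: "open S" "x \<in> S"
    and f: "\<And>z k. z \<in> S \<Longrightarrow> ((\<lambda>t. f (z + t *\<^sub>R axis k 1)) has_real_derivative g k z) (at 0)"
    and g: "\<And>k. continuous_on S (g k)"
  shows "(f has_derivative (\<lambda>w. (\<chi> k. g k x) \<bullet> w)) (at x)"
  unfolding has_derivative_at_alt
proof (intro conjI allI impI)
  show "bounded_linear (\<lambda>w. (\<chi> k. g k x) \<bullet> w)"
    by (rule bounded_linear_inner_right)
  fix e :: real assume e: "0 < e"
  define e' where "e' = e / CARD('n)"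
  have e': "0 < e'" using e by (simp add: e'_def)
  have "\<forall>\<^sub>F z in nhds x. z \<in> S \<and> (\<forall>k. \<bar>g k z - g k x\<bar> < e')"
  proof (intro eventually_conj eventually_all_finite)
    show "\<forall>\<^sub>F z in nhds x. z \<in> S" using S by (rule eventually_nhds_in_open)
    fix k
    have "isCont (g k) x"
      using g S continuous_on_eq_continuous_at by blast
    hence "(g k \<longlongrightarrow> g k x) (nhds x)"
      by (simp add: isCont_def tendsto_at_iff_tendsto_nhds)
    thus "\<forall>\<^sub>F z in nhds x. \<bar>g k z - g k x\<bar> < e'"
      using e' by (auto dest: tendstoD simp: dist_real_def)
  qed
  then obtain d where d: "0 < d"
    "\<And>z. dist z x < d \<Longrightarrow> z \<in> S \<and> (\<forall>k. \<bar>g k z - g k x\<bar> < e')"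
    unfolding eventually_nhds_metric by blast
  show "\<exists>d>0. \<forall>y. norm (y - x) < d \<longrightarrow> norm (f y - f x - (\<chi> k. g k x) \<bullet> (y - x)) \<le> e * norm (y - x)"
  proof (intro exI[of _ d] conjI d(1) allI impI)
    fix y assume y: "norm (y - x) < d"
    define w where "w = y - x"
    define r where "r I = (\<chi> k. if k \<in> I then w $ k else 0)" for I :: "'n set"
    have "\<bar>f (x + r I) - f x - (\<Sum>k\<in>I. g k x * w $ k)\<bar> \<le> (\<Sum>k\<in>I. e' * \<bar>w $ k\<bar>)" for I
      using finite[of I]
    proof (induction I rule: finite_induct)
      case empty
      have "r {} = 0" by (simp add: r_def vec_eq_iff)
      thus ?case by simp
    next
      case (insert j I)
      define c where "c = w $ j"
      define p where "p t = x + r I + (t * c) *\<^sub>R axis j 1" for t :: real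
      have near: "dist (p t) x < d" if "0 \<le> t" "t \<le> 1" for t
      proof -
        have "norm (r I + (t * c) *\<^sub>R axis j 1) \<le> norm w"
        proof (rule norm_le_componentwise_cart)
          fix i
          have "\<bar>t * c\<bar> \<le> \<bar>c\<bar>" using that by (simp add: abs_mult mult_left_le_one_le)
          thus "norm ((r I + (t * c) *\<^sub>R axis j 1) $ i) \<le> norm (w $ i)"
            using insert.hyps(2) by (auto simp: r_def axis_def c_def)
        qed
        thus ?thesis using y by (simp add: p_def dist_norm w_def add.assoc)
      qed
      have D: "((\<lambda>t. f (p t)) has_real_derivative (g j (p t) * c)) (at t)" if "0 \<le> t" "t \<le> 1" for t
      proof -
        have "((\<lambda>s. f (p t + s *\<^sub>R axis j 1)) has_real_derivative g j (p t)) (at ((t - t) * c))"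
          using f[of "p t" j] d(2)[OF near[OF that]] by simp
        moreover have "((\<lambda>s. (s - t) * c) has_real_derivative c) (at t)"
          by (auto intro!: derivative_eq_intros)
        ultimately have "((\<lambda>s. f (p t + ((s - t) * c) *\<^sub>R axis j 1)) has_real_derivative g j (p t) * c) (at t)"
          by (rule DERIV_chain2)
        moreover have "p t + ((s - t) * c) *\<^sub>R axis j 1 = p s" for s
          by (simp add: p_def algebra_simps)
        ultimately show ?thesis by simp
      qed
      have "\<exists>t>0. t < 1 \<and> f (p 1) - f (p 0) = (1 - 0) * (g j (p t) * c)"
        by (rule MVT2) (use D in auto)
      then obtain t where t: "0 < t" "t < 1" "f (p 1) - f (p 0) = g j (p t) * c"
        by auto
      have p: "p 0 = x + r I" "p 1 = x + r (insert j I)"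
        using insert.hyps(2) by (auto simp: p_def r_def vec_eq_iff axis_def c_def)
      have "\<bar>g j (p t) - g j x\<bar> \<le> e'"
        using d(2)[OF near[of t]] t(1,2) by (simp add: less_imp_le)
      hence "\<bar>(g j (p t) - g j x) * c\<bar> \<le> e' * \<bar>c\<bar>"
        by (simp only: abs_mult mult_right_mono abs_ge_zero)
      hence "\<bar>f (x + r (insert j I)) - f (x + r I) - g j x * c\<bar> \<le> e' * \<bar>c\<bar>"
        using t(3) by (simp only: p left_diff_distrib)
      thus ?case
        using insert.IH unfolding sum.insert[OF insert.hyps] c_def by linarith
    qed
    note step = this[of UNIV]
    have "x + r UNIV = y" by (simp add: r_def w_def vec_eq_iff)
    with step have "\<bar>f y - f x - (\<Sum>k\<in>UNIV. g k x * w $ k)\<bar> \<le> (\<Sum>k\<in>UNIV. e' * \<bar>w $ k\<bar>)"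
      by (simp only:)
    also have "\<dots> \<le> (\<Sum>k\<in>(UNIV::'n set). e' * norm w)"
      using e' by (intro sum_mono mult_left_mono component_le_norm_cart) auto
    also have "\<dots> = e * norm w" by (simp add: e'_def)
    finally show "norm (f y - f x - (\<chi> k. g k x) \<bullet> (y - x)) \<le> e * norm (y - x)"
      by (simp add: inner_vec_def w_def)
  qed
qed

lemma C_on_imp_partials_has_derivative:
  assumes S: "open S" "x \<in> S" and f: "C_on m S f" and ks: "length ks < m"
  shows "(partials ks f has_derivative (\<lambda>w. (\<chi> k. partials (k # ks) f x) \<bullet> w)) (at x)"
proof (rule has_derivative_of_continuous_partials[OF S])
  fix z k assume "z \<in> S"
  hence "(\<lambda>t. partials ks f (z + t *\<^sub>R axis k 1)) field_differentiable (at 0)"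
    using f ks unfolding C_on_def by blast
  thus "((\<lambda>t. partials ks f (z + t *\<^sub>R axis k 1)) has_real_derivative partials (k # ks) f z) (at 0)"
    by (simp add: field_differentiable_derivI partials_def partial_def)
next
  fix k show "continuous_on S (partials (k # ks) f)"
    using f ks unfolding C_on_def by (simp add: Suc_le_eq)
qed

section \<open>The Legendre transform\<close>

lemma matrix_inv_both_sides:
  fixes H :: "real^'n::finite^'n"
  assumes "det H \<noteq> 0"
  shows "H ** matrix_inv H = mat 1" "matrix_inv H ** H = mat 1"
proof -
  have "\<exists>B. H ** B = mat 1 \<and> B ** H = mat 1"
    using assms invertible_det_nz[of H] by (auto simp: invertible_def)
  from someI_ex[OF this] show "H ** matrix_inv H = mat 1" "matrix_inv H ** H = mat 1"
    by (auto simp: matrix_inv_def)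
qed

lemma pos_def_matrix_inv:
  fixes H :: "real^'n::finite^'n"
  assumes "pos_def H" "det H = 1"
  shows "pos_def (matrix_inv H)" "det (matrix_inv H) = 1"
proof -
  note inv = matrix_inv_both_sides[of H]
  have H: "H ** matrix_inv H = mat 1" "matrix_inv H ** H = mat 1" "transpose H = H"
    using inv assms by (auto simp: pos_def_def)
  have "transpose (matrix_inv H) ** H = mat 1"
    using arg_cong[OF H(1), of transpose] H(3) by (simp add: matrix_transpose_mul transpose_mat)
  hence "(transpose (matrix_inv H) ** H) ** matrix_inv H = matrix_inv H" by simp
  hence sym: "transpose (matrix_inv H) = matrix_inv H"
    by (simp add: matrix_mul_assoc[symmetric] H(1))
  have "0 < z \<bullet> (matrix_inv H *v z)" if "z \<noteq> 0" for z
  proof -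
    have z: "H *v (matrix_inv H *v z) = z" by (simp add: matrix_vector_mul_assoc H(1))
    have "matrix_inv H *v z \<noteq> 0"
      using that z by (auto simp del: matrix_vector_mul_assoc)
    hence "0 < (matrix_inv H *v z) \<bullet> (H *v (matrix_inv H *v z))"
      using assms(1) by (simp add: pos_def_def)
    thus ?thesis by (simp add: z inner_commute)
  qed
  thus "pos_def (matrix_inv H)" using sym by (simp add: pos_def_def)
  show "det (matrix_inv H) = 1"
    using arg_cong[OF H(1), of det] assms(2) by (simp add: det_mul)
qed

text \<open>Along the segment from \<open>a\<close> to \<open>b\<close> the component of \<open>g\<close> in the direction \<open>b - a\<close> strictly increases.\<close>

lemma gradient_inj_on:
  fixes g :: "real^'n::finite \<Rightarrow> real^'n"
  assumes "convex S"
    and g: "\<And>x. x \<in> S \<Longrightarrow> (g has_derivative (\<lambda>w. H x *v w)) (at x)"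
    and H: "\<And>x. x \<in> S \<Longrightarrow> pos_def (H x)"
  shows "inj_on g S"
proof (rule inj_onI, rule ccontr)
  fix a b assume ab: "a \<in> S" "b \<in> S" "g a = g b" "a \<noteq> b"
  define w where "w = b - a"
  have w: "w \<noteq> 0" using ab by (simp add: w_def)
  define f where "f t = w \<bullet> g (a + t *\<^sub>R w)" for t :: real
  have "f 0 < f 1"
  proof (rule DERIV_pos_imp_increasing[of 0 1 f])
    fix t :: real assume t: "0 \<le> t" "t \<le> 1"
    have "a + t *\<^sub>R w = (1 - t) *\<^sub>R a + t *\<^sub>R b" by (simp add: w_def algebra_simps)
    hence inS: "a + t *\<^sub>R w \<in> S"
      using t ab convexD_alt[OF assms(1)] by simp
    have "((\<lambda>t::real. a + t *\<^sub>R w) has_derivative (\<lambda>s. s *\<^sub>R w)) (at t)"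
      by (auto intro!: derivative_eq_intros)
    from has_derivative_compose[OF this g[OF inS]]
    have "(f has_derivative (\<lambda>s. w \<bullet> (H (a + t *\<^sub>R w) *v (s *\<^sub>R w)))) (at t)"
      unfolding f_def by (rule has_derivative_inner_right)
    hence "(f has_real_derivative w \<bullet> (H (a + t *\<^sub>R w) *v w)) (at t)"
      by (simp add: has_field_derivative_def matrix_vector_mult_scaleR mult_commute_abs)
    thus "\<exists>y. (f has_real_derivative y) (at t) \<and> 0 < y"
      using H[OF inS] w by (auto simp: pos_def_def)
  qed simp
  thus False using ab by (simp add: f_def w_def)
qed

text \<open>In the derivative of the Legendre transform the two terms with the derivative of \<open>G\<close> cancel, because
  \<open>g\<close> is the gradient of \<open>u\<close>. So its gradient is the inverse \<open>G\<close> of \<open>g\<close>, and its Hessian is the inverse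
  of that of \<open>u\<close>.\<close>

lemma legendre_transform_derivatives:
  fixes u :: "real^'n::finite \<Rightarrow> real"
  assumes S: "open S" "x \<in> S"
    and u: "\<And>x. x \<in> S \<Longrightarrow> (u has_derivative (\<lambda>w. g x \<bullet> w)) (at x)"
    and g: "\<And>x. x \<in> S \<Longrightarrow> (g has_derivative (\<lambda>w. H x *v w)) (at x)"
    and H: "det (H x) \<noteq> 0"
    and G: "\<And>x. x \<in> S \<Longrightarrow> G (g x) = x"
  shows "(G has_derivative (\<lambda>w. matrix_inv (H x) *v w)) (at (g x))"
    and "((\<lambda>y. y \<bullet> G y - u (G y)) has_derivative (\<lambda>w. x \<bullet> w)) (at (g x))"
proof -
  have cont: "continuous_on S g"
    using g by (intro continuous_at_imp_continuous_on) (blast intro: has_derivative_continuous)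
  show dG: "(G has_derivative (\<lambda>w. matrix_inv (H x) *v w)) (at (g x))"
    by (rule has_derivative_inverse_strong[OF S cont G g[OF S(2)]])
       (simp_all add: fun_eq_iff matrix_vector_mul_assoc matrix_inv_both_sides[OF H])
  have "(u has_derivative (\<lambda>w. g x \<bullet> w)) (at (G (g x)))"
    using u[OF S(2)] by (simp add: G[OF S(2)])
  from has_derivative_compose[OF dG this]
  have "((\<lambda>y. u (G y)) has_derivative (\<lambda>w. g x \<bullet> (matrix_inv (H x) *v w))) (at (g x))" .
  from has_derivative_diff[OF has_derivative_inner[OF has_derivative_ident dG] this]
  show "((\<lambda>y. y \<bullet> G y - u (G y)) has_derivative (\<lambda>w. x \<bullet> w)) (at (g x))"
    by (rule has_derivative_eq_rhs) (simp add: fun_eq_iff G[OF S(2)] inner_commute)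
qed

section \<open>Cofactors\<close>

definition matrix_cofactor :: "'n \<Rightarrow> 'n \<Rightarrow> real^'n::finite^'n \<Rightarrow> real" where
  "matrix_cofactor k l W = det (\<chi> i. if i = k then axis l 1 else W $ i)"

text \<open>The determinant is an affine function of a single entry.\<close>

lemma entry_deriv_det: "entry_deriv det k l W = matrix_cofactor k l W"
proof -
  have "det (\<chi> i j. if i = k \<and> j = l then t else W $ i $ j)
      = det W + (t - W $ k $ l) * matrix_cofactor k l W" for t
  proof -
    have "(\<chi> i j. if i = k \<and> j = l then t else W $ i $ j)
        = (\<chi> i. if i = k then W $ k + (t - W $ k $ l) *s axis l 1 else W $ i)"
      by (simp add: vec_eq_iff axis_def)
    also have "det \<dots> = det (\<chi> i. if i = k then W $ k else W $ i)
        + det (\<chi> i. if i = k then (t - W $ k $ l) *s axis l 1 else W $ i)"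
      by (rule det_row_add)
    also have "(\<chi> i. if i = k then W $ k else W $ i) = W"
      by (simp add: vec_eq_iff)
    also have "det (\<chi> i. if i = k then (t - W $ k $ l) *s axis l 1 else W $ i)
        = (t - W $ k $ l) * matrix_cofactor k l W"
      unfolding matrix_cofactor_def by (rule det_row_mul)
    finally show ?thesis .
  qed
  hence "entry_deriv det k l W
      = deriv (\<lambda>t. det W + (t - W $ k $ l) * matrix_cofactor k l W) (W $ k $ l)"
    by (simp add: entry_deriv_def)
  also have "\<dots> = matrix_cofactor k l W"
    by (rule DERIV_imp_deriv) (auto intro!: derivative_eq_intros)
  finally show ?thesis .
qed

text \<open>Cramer's rule for the system \<open>W z = e\<^sub>l\<close>, whose solution is the \<open>l\<close>-th column of the inverse. Symmetry
  turns the replaced row into the replaced column of that rule.\<close>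

lemma matrix_cofactor_eq_inverse_entry:
  fixes W :: "real^'n::finite^'n"
  assumes sym: "transpose W = W" and det: "det W = 1"
  shows "matrix_cofactor k l W = matrix_inv W $ k $ l"
proof -
  define z where "z = matrix_inv W *v axis l 1"
  have z: "W *v z = axis l 1"
    using matrix_inv_both_sides[of W] det by (simp add: z_def matrix_vector_mul_assoc)
  have W: "W $ i $ j = W $ j $ i" for i j
    using arg_cong[OF sym, of "\<lambda>M. M $ i $ j"] by (simp add: transpose_def)
  have "transpose (\<chi> i. if i = k then axis l 1 else W $ i)
      = (\<chi> i j. if j = k then (W *v z) $ i else W $ i $ j)"
    by (simp add: z vec_eq_iff transpose_def W)
  from arg_cong[OF this, of det]
  have "matrix_cofactor k l W = det (\<chi> i j. if j = k then (W *v z) $ i else W $ i $ j)"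
    by (simp only: matrix_cofactor_def det_transpose)
  also have "\<dots> = z $ k" by (simp add: cramer_lemma det)
  also have "\<dots> = matrix_inv W $ k $ l"
    by (simp add: z_def matrix_vector_mul_component inner_axis)
  finally show ?thesis .
qed

lemma continuous_on_det:
  fixes M :: "'a::topological_space \<Rightarrow> real^'n::finite^'n"
  assumes "\<And>i j. continuous_on S (\<lambda>x. M x $ i $ j)"
  shows "continuous_on S (\<lambda>x. det (M x))"
  unfolding det_def by (intro continuous_intros assms)

lemma continuous_on_matrix_cofactor:
  fixes M :: "'a::topological_space \<Rightarrow> real^'n::finite^'n"
  assumes "\<And>i j. continuous_on S (\<lambda>x. M x $ i $ j)"
  shows "continuous_on S (\<lambda>x. matrix_cofactor k l (M x))"
  unfolding matrix_cofactor_def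
proof (rule continuous_on_det)
  fix i j
  show "continuous_on S (\<lambda>x. (\<chi> i. if i = k then axis l 1 else M x $ i) $ i $ j)"
    using assms by (cases "i = k") auto
qed

section \<open>The function phi and its maximum\<close>

text \<open>On the boundary the limit from inside coincides with the value of the continuous extension that
  \<^const>\<open>C_closure\<close> provides.\<close>

lemma continuous_on_closure_ext:
  fixes f :: "real^'n::finite \<Rightarrow> real"
  assumes S: "open S" and f: "C_closure m S f" and ks: "length ks \<le> m"
  shows "continuous_on (closure S) (closure_ext S (partials ks f))"
proof -
  obtain g where g: "continuous_on (closure S) g" "\<And>x. x \<in> S \<Longrightarrow> g x = partials ks f x"
    using f ks unfolding C_closure_def by blast
  have "closure_ext S (partials ks f) x = g x" if x: "x \<in> closure S" for x
  proof (cases "x \<in> S")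
    case False
    have "(g \<longlongrightarrow> g x) (at x within closure S)"
      using g(1) x by (simp add: continuous_on_def)
    hence "(g \<longlongrightarrow> g x) (at x within S)"
      by (rule tendsto_within_subset) (rule closure_subset)
    moreover have "\<forall>\<^sub>F z in at x within S. g z = partials ks f z"
      using g(2) by (simp add: eventually_at_filter)
    ultimately have "(partials ks f \<longlongrightarrow> g x) (at x within S)"
      by (rule Lim_transform_eventually)
    moreover have "at x within S \<noteq> bot"
      using x False by (simp add: trivial_limit_within closure_def)
    ultimately show ?thesis
      using False by (simp add: closure_ext_def tendsto_Lim)
  qed (simp add: g(2) closure_ext_def)
  thus ?thesis using continuous_on_cong[OF refl, of "closure S" g "closure_ext S (partials ks f)"] g(1)
    by simp
qed

lemma continuous_on_phi:
  assumes S: "open S" and f: "C_closure 2 S f"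
  shows "continuous_on (closure S) (phi S f)"
proof -
  have sig: "sigma CARD('n) = (det :: real^'n^'n \<Rightarrow> real)"
    by (simp add: fun_eq_iff sigma_top_eq_det)
  have d1: "continuous_on (closure S) (closure_ext S (partial k f))" for k
    using continuous_on_closure_ext[OF S f, of "[k]"] by (simp add: partials_def)
  have d2: "continuous_on (closure S) (\<lambda>x. hessian S f x $ k $ l)" for k l
    using continuous_on_closure_ext[OF S f, of "[k, l]"] by (simp add: hessian_def)
  have "continuous_on (closure S) f" using f by (simp add: C_closure_def)
  thus ?thesis
    unfolding phi_def[abs_def] sig entry_deriv_det
    by (intro continuous_intros d1 continuous_on_matrix_cofactor d2)
qed

lemma phi_eq_inverse_form:
  fixes x :: "real^'n::finite"
  assumes x: "x \<in> S" and H: "transpose (hessian S f x) = hessian S f x" "det (hessian S f x) = 1"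
  shows "phi S f x = (\<chi> k. partial k f x) \<bullet> (matrix_inv (hessian S f x) *v (\<chi> k. partial k f x)) - 2 * f x"
proof -
  have sig: "sigma CARD('n) = (det :: real^'n^'n \<Rightarrow> real)"
    by (simp add: fun_eq_iff sigma_top_eq_det)
  show ?thesis
    unfolding phi_def sig entry_deriv_det matrix_cofactor_eq_inverse_entry[OF H]
    by (simp add: closure_ext_def x inner_vec_def matrix_vector_mult_def sum_distrib_left mult_ac)
qed

theorem theorem1p1:
  fixes \<Omega> :: "(real^'n::finite) set" and u :: "real^'n \<Rightarrow> real"
  assumes "CARD('n) \<ge> 2"
    and "open \<Omega>" and "\<Omega> \<noteq> {}" and "bounded \<Omega>" and "convex \<Omega>"
    and "smooth_on \<Omega> u" and "C_closure 2 \<Omega> u"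
    and "\<forall>x\<in>\<Omega>. pos_def (hessian \<Omega> u x)"
    and "\<forall>x\<in>\<Omega>. det (hessian \<Omega> u x) = 1"
    and "\<forall>x\<in>frontier \<Omega>. u x = 0"
  shows "\<exists>x\<in>frontier \<Omega>. \<forall>y\<in>closure \<Omega>. phi \<Omega> u y \<le> phi \<Omega> u x"
proof -
  define g :: "real^'n \<Rightarrow> real^'n" where "g x = (\<chi> k. partials [k] u x)" for x
  define H where "H x = hessian \<Omega> u x" for x
  have H: "pos_def (H x)" "transpose (H x) = H x" "det (H x) = 1" if "x \<in> \<Omega>" for x
    using assms(8,9) that by (auto simp: H_def pos_def_def)
  have C2: "C_on 2 \<Omega> u" using assms(7) by (simp add: C_closure_def)
  have u: "(u has_derivative (\<lambda>w. g x \<bullet> w)) (at x)" if "x \<in> \<Omega>" for x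
    using C_on_imp_partials_has_derivative[OF assms(2) that C2, of "[]"]
    by (simp add: g_def partials_def)
  have g: "(g has_derivative (\<lambda>w. H x *v w)) (at x)" if x: "x \<in> \<Omega>" for x
  proof -
    have sym: "H x $ k $ l = H x $ l $ k" for k l
      using arg_cong[OF H(2)[OF x], of "\<lambda>M. M $ l $ k"] by (simp add: transpose_def)
    have row: "(H x *v w) $ l = (\<chi> k. partials [k, l] u x) \<bullet> w" for w l
    proof -
      have "(\<chi> k. partials [k, l] u x) = H x $ l"
        using sym[of l] x by (simp add: vec_eq_iff H_def hessian_def closure_ext_def)
      thus ?thesis by (simp add: matrix_vector_mul_component)
    qed
    have "((\<lambda>y. g y $ l) has_derivative (\<lambda>w. (H x *v w) $ l)) (at x)" for l
      using C_on_imp_partials_has_derivative[OF assms(2) x C2, of "[l]"]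
      unfolding row by (simp add: g_def)
    thus ?thesis
      unfolding has_derivative_componentwise_within[of g]
      by (auto simp: Basis_vec_def inner_axis)
  qed
  have inj: "inj_on g \<Omega>"
    by (rule gradient_inj_on[OF assms(5) g H(1)])
  have contg: "continuous_on \<Omega> g"
    using g by (intro continuous_at_imp_continuous_on) (blast intro: has_derivative_continuous)
  \<comment> \<open>\<open>v\<close> is the Legendre transform of \<open>u\<close>, with gradient \<open>G\<close> and Hessian \<open>A\<close>; \<open>P\<close> is \<open>\<phi>\<close> in the gradient
    variable.\<close>
  define V where "V = g ` \<Omega>"
  define G where "G = inv_into \<Omega> g"
  define v where "v y = y \<bullet> G y - u (G y)" for y
  define A where "A y = matrix_inv (H (G y))" for y
  define P where "P y = 2 * v y - 2 * (y \<bullet> G y) + y \<bullet> (A y *v y)" for y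
  have Gg: "G (g x) = x" if "x \<in> \<Omega>" for x
    using inj that by (simp add: G_def)
  have V: "open V"
    unfolding V_def using contg assms(2) inj by (rule invariance_of_domain)
  have nz: "det (H x) \<noteq> 0" if "x \<in> \<Omega>" for x using H(3)[OF that] by simp
  have dG: "(G has_derivative (\<lambda>w. A y *v w)) (at y)" if "y \<in> V" for y
    using that legendre_transform_derivatives(1)[OF assms(2) _ u g nz Gg]
    by (auto simp: V_def A_def Gg)
  have dv: "(v has_derivative (\<lambda>w. G y \<bullet> w)) (at y)" if "y \<in> V" for y
    using that legendre_transform_derivatives(2)[OF assms(2) _ u g nz Gg]
    by (auto simp: V_def v_def[abs_def] Gg)
  have A: "pos_def (A y)" "det (A y) = 1" if "y \<in> V" for y
    using that pos_def_matrix_inv[OF H(1) H(3)] by (auto simp: V_def A_def Gg)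
  have Pg: "P (g x) = phi \<Omega> u x" if x: "x \<in> \<Omega>" for x
  proof -
    have "g x = (\<chi> k. partial k u x)" by (simp add: g_def partials_def)
    with phi_eq_inverse_form[OF x H(2,3)[OF x, unfolded H_def]]
    have "phi \<Omega> u x = g x \<bullet> (matrix_inv (H x) *v g x) - 2 * u x" by (simp only: H_def)
    thus ?thesis by (simp add: P_def v_def A_def Gg[OF x])
  qed
  have phi: "continuous_on (closure \<Omega>) (phi \<Omega> u)"
    using assms(2,7) by (rule continuous_on_phi)
  have "continuous_on V G"
    using dG by (intro continuous_at_imp_continuous_on) (blast intro: has_derivative_continuous)
  hence "continuous_on V (\<lambda>y. phi \<Omega> u (G y))"
    by (rule continuous_on_compose2[OF phi])
       (use Gg closure_subset in \<open>fastforce simp: V_def\<close>)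
  moreover have "P y = phi \<Omega> u (G y)" if "y \<in> V" for y
    using that Pg Gg by (auto simp: V_def)
  ultimately have contP: "continuous_on V P"
    using continuous_on_cong[OF refl, of V P "\<lambda>y. phi \<Omega> u (G y)"] by simp
  have "compact (frontier \<Omega>)" using assms(4) by (rule compact_frontier_bounded)
  moreover have "frontier \<Omega> \<noteq> {}"
    using assms(3,4) not_bounded_UNIV by (metis frontier_not_empty)
  moreover have "continuous_on (frontier \<Omega>) (phi \<Omega> u)"
    using phi by (rule continuous_on_subset) (simp add: frontier_def)
  ultimately obtain z where z: "z \<in> frontier \<Omega>" "\<And>x. x \<in> frontier \<Omega> \<Longrightarrow> phi \<Omega> u x \<le> phi \<Omega> u z"
    using continuous_attains_sup by metis
  have "phi \<Omega> u y \<le> phi \<Omega> u z" if y: "y \<in> closure \<Omega>" for y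
  proof (rule ccontr)
    assume gt: "\<not> phi \<Omega> u y \<le> phi \<Omega> u z"
    \<comment> \<open>A level \<open>m\<close> strictly between makes the superlevel set \<open>K\<close> a compact subset of the open set
      \<open>\<Omega>\<close>, to which the maximum principle applies.\<close>
    define m where "m = (phi \<Omega> u y + phi \<Omega> u z) / 2"
    have m: "phi \<Omega> u z < m" "m < phi \<Omega> u y" using gt by (auto simp: m_def)
    define K where "K = {x \<in> closure \<Omega>. m \<le> phi \<Omega> u x}"
    have K\<Omega>: "K \<subseteq> \<Omega>"
    proof
      fix x assume x: "x \<in> K"
      have "x \<notin> frontier \<Omega>" using z(2)[of x] m x by (auto simp: K_def)
      thus "x \<in> \<Omega>" using x assms(2) by (auto simp: K_def frontier_def interior_open)
    qed
    have "closed K"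
      unfolding K_def by (intro continuous_on_closed_Collect_le phi continuous_intros) simp
    moreover have "bounded K"
      using K\<Omega> assms(4) bounded_subset by blast
    ultimately have "compact K" by (simp add: compact_eq_bounded_closed)
    define Y where "Y = g ` K"
    have Y: "compact Y" "Y \<subseteq> V"
      unfolding Y_def V_def using K\<Omega> \<open>compact K\<close> continuous_on_subset[OF contg]
      by (auto intro: compact_continuous_image)
    have yK: "y \<in> K" using y m by (simp add: K_def)
    have "P (g y) \<le> m"
    proof (rule dilation_second_derivative_maximum_principle[OF V dv dG A P_def contP Y])
      show "g y \<in> Y" using yK by (simp add: Y_def)
      fix q assume q: "q \<in> frontier Y"
      have "open (V \<inter> P -` {m<..})"
        using contP V by (rule continuous_open_preimage) simp
      moreover have "V \<inter> P -` {m<..} \<subseteq> Y"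
        using closure_subset by (fastforce simp: V_def Y_def K_def Pg)
      ultimately have "V \<inter> P -` {m<..} \<subseteq> interior Y" by (simp add: interior_maximal)
      moreover have "q \<in> V" "q \<notin> interior Y"
        using q Y compact_imp_closed[OF Y(1)] by (auto simp: frontier_def closure_closed)
      ultimately show "P q \<le> m" by force
    qed
    thus False using Pg[of y] yK K\<Omega> m by auto
  qed
  thus ?thesis using z(1) by blast
qed

end
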